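(* Let $\widetilde D=[d_1\cdots d_{q-1}]\in\mathbb{R}^{n\times(q-1)}$ where $2\le q\le n$. Define $D(x):\mathbb{R}^n\to\mathbb{R}^{n\times q}$ by $D(x)=[\widetilde D~x]$. Let $\Delta>0$. Then for all $x\in\mathbb{R}^n$ with $\|x\|=\Delta$, $$\sigma_{\min}(D(x))\le\min\left\{\sigma_{\min}(\widetilde D),\Delta\right\}.$$ In particular, if $x^*\in\mathbb{R}^n$ with $\|x^*\|=\Delta$ satisfies $d_i^\top x^*=0$ for all $i\in\{1,\dots,q-1\}$, then $$\sigma_{\min}(D(x^* ))=\min\left\{\sigma_{\min}(\widetilde D),\Delta\right\}.$$
   Context: $\|\cdot\|$ is the Euclidean norm. $\sigma_{\min}(M)$ is the minimum singular value of a matrix; for $M\in\mathbb{R}^{n\times z}$ with $z\le n$, $\sigma_{\min}(M)=\min_{\|y\|=1}\|My\|=\sqrt{\lambda_{\min}(M^\top M)}$. $[\widetilde D~x]$ denotes the matrix obtained by appending $x$ as last column to $\widetilde D$. *)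

theory Defs
  imports "Jordan_Normal_Form.Spectral_Radius"
begin

definition vnorm :: "real vec \<Rightarrow> real" where
  "vnorm v = sqrt (v \<bullet> v)"

text \<open>The \<open>min m n\<close> singular values of an \<open>m \<times> n\<close> matrix are the square roots of the
  eigenvalues of the smaller of its two Gram matrices; using the larger one would add
  spurious zeros. That Gram matrix is real symmetric, so the real spectrum used here
  contains all its eigenvalues.\<close>

definition singular_values :: "real mat \<Rightarrow> real set" where
  "singular_values M = sqrt `
     spectrum (if dim_col M \<le> dim_row M then transpose_mat M * M else M * transpose_mat M)"

definition sigma_min :: "real mat \<Rightarrow> real" where
  "sigma_min M = Min (singular_values M)"

definition append_col :: "'a mat \<Rightarrow> 'a vec \<Rightarrow> 'a mat" where
  "append_col M x = mat_of_cols (dim_row M) (cols M @ [x])"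

end

theory Submission
  imports Defs
begin

text \<open>For a tall matrix \<open>M\<close> the number \<open>sigma_min M ^ 2\<close> is the least eigenvalue of the Gram
  matrix \<open>A\<close>, and it is the attained minimum of the Rayleigh quotient. The attainment is proved without
  compactness: if \<open>\<mu>\<close> is the infimum of the quotient, then \<open>B = A - \<mu> I\<close> is positive semidefinite,
  so \<open>|B y|^4 \<le> (y \<bullet> B y) (B y \<bullet> B B y)\<close>; if \<open>B\<close> were invertible this would bound
  \<open>y \<bullet> B y\<close> below by a positive multiple of \<open>|y|^2\<close>, contradicting the choice of \<open>\<mu>\<close>. Hence \<open>\<mu>\<close> is an
  eigenvalue. The theorem follows by testing \<open>[M x] (y, t) = M y + t x\<close> on \<open>(y, 0)\<close> and \<open>(0, 1)\<close> and,
  in the orthogonal case, by Pythagoras.\<close>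

section \<open>Cauchy-Schwarz for positive semidefinite forms\<close>

lemma scalar_prod_self_nonneg: "0 \<le> v \<bullet> (v :: real vec)"
  by (auto simp: scalar_prod_def intro!: sum_nonneg)

lemma scalar_prod_self_pos:
  assumes "(v :: real vec) \<in> carrier_vec n" "v \<noteq> 0\<^sub>v n"
  shows "0 < v \<bullet> v"
proof -
  obtain i where i: "i < n" "v $ i \<noteq> 0" using assms by (auto simp: vec_eq_iff)
  have "0 < v $ i * v $ i" using i by (metis not_real_square_gt_zero)
  also have "\<dots> \<le> v \<bullet> v" unfolding scalar_prod_def
    by (rule member_le_sum) (use i assms in auto)
  finally show ?thesis .
qed

lemma discriminant_nonpos:
  fixes a b c :: real
  assumes "\<And>s t. 0 \<le> s\<^sup>2 * c + 2 * s * t * b + t\<^sup>2 * a"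
  shows "b\<^sup>2 \<le> a * c"
proof (cases "c = 0")
  case True
  have "b = 0"
  proof (rule ccontr)
    assume "b \<noteq> 0"
    \<comment> \<open>For \<open>c = 0\<close> and \<open>t = 1\<close> the form is
      \<open>2 * s * b + a\<close>; this \<open>s\<close> makes it -1.\<close>
    then show False using assms[of "- (a + 1) / (2 * b)" 1] True by (simp add: field_simps)
  qed
  then show ?thesis using True by simp
next
  case False
  then have "0 < c" using assms[of 1 0] by simp
  \<comment> \<open>The form is evaluated at \<open>(b, - c)\<close>: for \<open>t = - c\<close> its
    minimum over \<open>s\<close> lies at \<open>s = b\<close>.\<close>
  moreover have "0 \<le> c * (a * c - b\<^sup>2)"
    using assms[of b "- c"] by (simp add: power2_eq_square algebra_simps)
  ultimately show ?thesis by (simp add: zero_le_mult_iff)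
qed

lemma symmetric_mult_mat_vec_commute:
  fixes A :: "real mat"
  assumes "A \<in> carrier_mat n n" "transpose_mat A = A" "x \<in> carrier_vec n" "y \<in> carrier_vec n"
  shows "y \<bullet> (A *\<^sub>v x) = x \<bullet> (A *\<^sub>v y)"
  using transpose_vec_mult_scalar[of A n n x y] assms
    comm_scalar_prod[of "A *\<^sub>v y" n x] by simp

text \<open>The form of \<open>A\<close> on the span of \<open>x\<close> and \<open>y\<close> is a
  nonnegative quadratic form in two coefficients; symmetry of \<open>A\<close> merges its two mixed
  terms, and the bound is the sign of its discriminant.\<close>

lemma psd_cauchy_schwarz:
  fixes A :: "real mat"
  assumes A: "A \<in> carrier_mat n n" "transpose_mat A = A"
    and psd: "\<And>y. y \<in> carrier_vec n \<Longrightarrow> 0 \<le> y \<bullet> (A *\<^sub>v y)"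
    and x: "x \<in> carrier_vec n" and y: "y \<in> carrier_vec n"
  shows "(x \<bullet> (A *\<^sub>v y))\<^sup>2 \<le> (y \<bullet> (A *\<^sub>v y)) * (x \<bullet> (A *\<^sub>v x))"
proof (rule discriminant_nonpos)
  fix s t
  have [simp]: "A *\<^sub>v x \<in> carrier_vec n" "A *\<^sub>v y \<in> carrier_vec n" using A x y by auto
  have "0 \<le> (s \<cdot>\<^sub>v x + t \<cdot>\<^sub>v y) \<bullet> (A *\<^sub>v (s \<cdot>\<^sub>v x + t \<cdot>\<^sub>v y))"
    by (rule psd) (use x y in auto)
  also have "A *\<^sub>v (s \<cdot>\<^sub>v x + t \<cdot>\<^sub>v y) = s \<cdot>\<^sub>v (A *\<^sub>v x) + t \<cdot>\<^sub>v (A *\<^sub>v y)"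
    using x y A by (simp add: mult_add_distrib_mat_vec[of A n n] mult_mat_vec[of A n n])
  also have "(s \<cdot>\<^sub>v x + t \<cdot>\<^sub>v y) \<bullet> \<dots> =
      s\<^sup>2 * (x \<bullet> (A *\<^sub>v x)) + 2 * s * t * (x \<bullet> (A *\<^sub>v y)) + t\<^sup>2 * (y \<bullet> (A *\<^sub>v y))"
    using x y symmetric_mult_mat_vec_commute[OF A x y]
    by (simp add: add_scalar_prod_distrib[of _ n] scalar_prod_add_distrib[of _ n]
        power2_eq_square algebra_simps)
  finally show "0 \<le> s\<^sup>2 * (x \<bullet> (A *\<^sub>v x)) + 2 * s * t * (x \<bullet> (A *\<^sub>v y)) + t\<^sup>2 * (y \<bullet> (A *\<^sub>v y))" .
qed

lemma scalar_prod_cauchy_schwarz: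
  fixes x y :: "real vec"
  assumes "x \<in> carrier_vec n" "y \<in> carrier_vec n"
  shows "(x \<bullet> y)\<^sup>2 \<le> (x \<bullet> x) * (y \<bullet> y)"
  using psd_cauchy_schwarz[of "1\<^sub>m n" n x y] assms
  by (simp add: scalar_prod_self_nonneg mult.commute)

section \<open>Coercivity and the least eigenvalue\<close>

lemma mult_mat_vec_bounded:
  fixes A :: "real mat"
  assumes A: "A \<in> carrier_mat m n"
  obtains C where "0 < C" "\<And>y. y \<in> carrier_vec n \<Longrightarrow> (A *\<^sub>v y) \<bullet> (A *\<^sub>v y) \<le> C * (y \<bullet> y)"
proof
  \<comment> \<open>The sum is the squared Frobenius norm, from Cauchy-Schwarz in each row; adding 1
    keeps the constant positive for a zero matrix.\<close>
  let ?C = "1 + (\<Sum>i<m. row A i \<bullet> row A i)"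
  show "0 < ?C" by (intro add_pos_nonneg sum_nonneg) (auto simp: scalar_prod_self_nonneg)
  fix y :: "real vec" assume y: "y \<in> carrier_vec n"
  have "(A *\<^sub>v y) \<bullet> (A *\<^sub>v y) = (\<Sum>i<m. (row A i \<bullet> y)\<^sup>2)"
    using A by (auto simp: scalar_prod_def[of _ "A *\<^sub>v y"] power2_eq_square lessThan_atLeast0)
  also have "\<dots> \<le> (\<Sum>i<m. (row A i \<bullet> row A i) * (y \<bullet> y))"
    by (intro sum_mono scalar_prod_cauchy_schwarz[of _ n]) (use A y in auto)
  also have "\<dots> \<le> ?C * (y \<bullet> y)"
    by (simp add: distrib_right sum_distrib_right scalar_prod_self_nonneg)
  finally show "(A *\<^sub>v y) \<bullet> (A *\<^sub>v y) \<le> ?C * (y \<bullet> y)" .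
qed

text \<open>Cauchy-Schwarz for the form of \<open>B\<close> bounds \<open>|B y|^2\<close> by a
  multiple of \<open>y \<bullet> B y\<close>, and an inverse of \<open>B\<close> bounds
  \<open>|y|^2\<close> by a multiple of \<open>|B y|^2\<close>.\<close>

lemma psd_nonsingular_coercive:
  fixes B :: "real mat"
  assumes B: "B \<in> carrier_mat n n" "transpose_mat B = B"
    and psd: "\<And>y. y \<in> carrier_vec n \<Longrightarrow> 0 \<le> y \<bullet> (B *\<^sub>v y)"
    and det: "det B \<noteq> 0"
  obtains \<delta> where "0 < \<delta>" "\<And>y. y \<in> carrier_vec n \<Longrightarrow> \<delta> * (y \<bullet> y) \<le> y \<bullet> (B *\<^sub>v y)"
proof -
  obtain K where K: "K \<in> carrier_mat n n" "K * B = 1\<^sub>m n"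
    using det_non_zero_imp_unit[OF B(1) det, of "()"]
    by (auto simp: Units_def ring_mat_def)
  obtain C where C: "0 < C" "\<And>y. y \<in> carrier_vec n \<Longrightarrow> (B *\<^sub>v y) \<bullet> (B *\<^sub>v y) \<le> C * (y \<bullet> y)"
    using mult_mat_vec_bounded[OF B(1)] by blast
  obtain E where E: "0 < E" "\<And>y. y \<in> carrier_vec n \<Longrightarrow> (K *\<^sub>v y) \<bullet> (K *\<^sub>v y) \<le> E * (y \<bullet> y)"
    using mult_mat_vec_bounded[OF K(1)] by blast
  \<comment> \<open>An upper bound on the form follows from ordinary Cauchy-Schwarz;
    \<open>C \<le> (1 + C)^2\<close> allows \<open>1 + C\<close> as constant without taking a root
    of \<open>C\<close>.\<close>
  obtain F where F: "0 < F" "\<And>y. y \<in> carrier_vec n \<Longrightarrow> y \<bullet> (B *\<^sub>v y) \<le> F * (y \<bullet> y)"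
  proof
    show "0 < 1 + C" using C by simp
    fix y :: "real vec" assume y: "y \<in> carrier_vec n"
    have By: "B *\<^sub>v y \<in> carrier_vec n" using B y by auto
    have "(y \<bullet> (B *\<^sub>v y))\<^sup>2 \<le> (y \<bullet> y) * ((B *\<^sub>v y) \<bullet> (B *\<^sub>v y))"
      by (rule scalar_prod_cauchy_schwarz[OF y By])
    also have "\<dots> \<le> (y \<bullet> y) * (C * (y \<bullet> y))"
      by (intro mult_left_mono C y scalar_prod_self_nonneg)
    also have "\<dots> \<le> ((1 + C) * (y \<bullet> y))\<^sup>2"
      using C(1) by (simp add: power2_eq_square algebra_simps)
    finally show "y \<bullet> (B *\<^sub>v y) \<le> (1 + C) * (y \<bullet> y)"
      by (rule power2_le_imp_le) (use C in \<open>simp add: scalar_prod_self_nonneg\<close>)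
  qed
  show ?thesis
  proof
    show "0 < 1 / (E * F)" using E F by simp
    fix y :: "real vec" assume y: "y \<in> carrier_vec n"
    let ?x = "B *\<^sub>v y"
    have x: "?x \<in> carrier_vec n" using B y by auto
    have "(?x \<bullet> ?x)\<^sup>2 \<le> (y \<bullet> ?x) * (?x \<bullet> (B *\<^sub>v ?x))"
      by (rule psd_cauchy_schwarz[OF B psd x y])
    also have "\<dots> \<le> (y \<bullet> ?x) * (F * (?x \<bullet> ?x))"
      by (intro mult_left_mono F x psd y)
    \<comment> \<open>One factor \<open>?x \<bullet> ?x\<close> cancels; if it is zero, the claim is
      just semidefiniteness.\<close>
    finally have xx: "?x \<bullet> ?x \<le> F * (y \<bullet> ?x)"
      using psd[OF y] F(1) scalar_prod_self_nonneg[of ?x]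
      by (cases "?x \<bullet> ?x = 0") (auto simp: power2_eq_square mult_ac mult_le_cancel_left)
    have "K *\<^sub>v ?x = y" using K B y by (simp flip: assoc_mult_mat_vec[of K n n B n])
    then have "y \<bullet> y \<le> E * (?x \<bullet> ?x)" using E(2)[OF x] by simp
    also have "\<dots> \<le> E * (F * (y \<bullet> ?x))" using xx E by simp
    finally show "1 / (E * F) * (y \<bullet> y) \<le> y \<bullet> ?x" using E F by (simp add: field_simps)
  qed
qed

lemma symmetric_psd_min_eigenvalue:
  fixes A :: "real mat"
  assumes A: "A \<in> carrier_mat n n" "transpose_mat A = A" and n: "0 < n"
    and psd: "\<And>y. y \<in> carrier_vec n \<Longrightarrow> 0 \<le> y \<bullet> (A *\<^sub>v y)"
  obtains \<mu> where "0 \<le> \<mu>" "\<mu> \<in> spectrum A"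
    "\<And>y. y \<in> carrier_vec n \<Longrightarrow> \<mu> * (y \<bullet> y) \<le> y \<bullet> (A *\<^sub>v y)"
proof -
  let ?Q = "\<lambda>y. (y \<bullet> (A *\<^sub>v y)) / (y \<bullet> y)"
  let ?S = "carrier_vec n - {0\<^sub>v n :: real vec}"
  define \<mu> where "\<mu> = (INF y\<in>?S. ?Q y)"
  \<comment> \<open>Since \<open>0 < n\<close> there is a nonzero vector, so the infimum defining
    \<open>\<mu>\<close> ranges over a nonempty set.\<close>
  have "unit_vec n 0 \<in> ?S" using unit_vec_nonzero[OF n] by simp
  then have S: "?S \<noteq> {}" by blast
  have Q0: "0 \<le> ?Q y" if "y \<in> ?S" for y
    using psd[of y] that scalar_prod_self_nonneg[of y] by simp
  have bdd: "bdd_below (?Q ` ?S)" using Q0 by (auto intro!: bdd_belowI2)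
  have \<mu>0: "0 \<le> \<mu>" unfolding \<mu>_def by (rule cINF_greatest[OF S Q0])
  have low: "\<mu> * (y \<bullet> y) \<le> y \<bullet> (A *\<^sub>v y)" if y: "y \<in> carrier_vec n" for y
  proof (cases "y = 0\<^sub>v n")
    case True
    then show ?thesis using psd[OF y] by simp
  next
    case False
    then have "\<mu> \<le> ?Q y" unfolding \<mu>_def using y by (intro cINF_lower[OF bdd]) auto
    then show ?thesis using scalar_prod_self_pos[OF y False] by (simp add: field_simps)
  qed
  let ?B = "A - \<mu> \<cdot>\<^sub>m 1\<^sub>m n"
  have B: "?B \<in> carrier_mat n n" using A by auto
  have Bv: "?B *\<^sub>v y = A *\<^sub>v y - \<mu> \<cdot>\<^sub>v y" if y: "y \<in> carrier_vec n" for y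
  proof -
    have "(\<mu> \<cdot>\<^sub>m 1\<^sub>m n) *\<^sub>v y = \<mu> \<cdot>\<^sub>v y"
      using y by (intro eq_vecI) auto
    then show ?thesis using A y by (simp add: minus_mult_distrib_mat_vec[of A n n])
  qed
  have yBy: "y \<bullet> (?B *\<^sub>v y) = y \<bullet> (A *\<^sub>v y) - \<mu> * (y \<bullet> y)" if y: "y \<in> carrier_vec n" for y
    unfolding Bv[OF y] using A y by (subst scalar_prod_minus_distrib[of _ n]) auto
  have "A $$ (j, i) = A $$ (i, j)" if "i < n" "j < n" for i j
    using that A by (metis carrier_matD index_transpose_mat(1))
  then have symB: "transpose_mat ?B = ?B" using A(1) by (intro eq_matI) auto
  have "det ?B = 0"
  proof (rule ccontr)
    assume "det ?B \<noteq> 0"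
    then obtain \<delta> where \<delta>: "0 < \<delta>" "\<And>y. y \<in> carrier_vec n \<Longrightarrow> \<delta> * (y \<bullet> y) \<le> y \<bullet> (?B *\<^sub>v y)"
      using psd_nonsingular_coercive[OF B symB] low yBy by (metis diff_ge_0_iff_ge)
    \<comment> \<open>Coercivity of \<open>?B\<close> lifts every Rayleigh quotient of
      \<open>A\<close> to at least \<open>\<mu> + \<delta>\<close>, above their infimum.\<close>
    have "\<mu> + \<delta> \<le> (INF y\<in>?S. ?Q y)"
    proof (rule cINF_greatest[OF S])
      fix y assume "y \<in> ?S"
      then show "\<mu> + \<delta> \<le> ?Q y"
        using \<delta>(2)[of y] yBy[of y] scalar_prod_self_pos[of y n] by (simp add: field_simps)
    qed
    then show False using \<delta>(1) unfolding \<mu>_def by simp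
  qed
  then obtain v where v: "v \<in> carrier_vec n" "v \<noteq> 0\<^sub>v n" "?B *\<^sub>v v = 0\<^sub>v n"
    using det_0_iff_vec_prod_zero[OF B] by blast
  have "A *\<^sub>v v = \<mu> \<cdot>\<^sub>v v"
  proof (rule eq_vecI)
    fix i assume "i < dim_vec (\<mu> \<cdot>\<^sub>v v)"
    then show "(A *\<^sub>v v) $ i = (\<mu> \<cdot>\<^sub>v v) $ i"
      using v(1) A(1) arg_cong[OF trans[OF Bv[OF v(1), symmetric] v(3)], of "\<lambda>u. u $ i"] by simp
  qed (use A v in auto)
  then have "\<mu> \<in> spectrum A"
    using v A by (auto simp: spectrum_def eigenvalue_def eigenvector_def)
  then show ?thesis using that \<mu>0 low by blast
qed

section \<open>Rayleigh description of the least singular value\<close>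

lemma sigma_min_rayleigh:
  fixes M :: "real mat"
  assumes M: "M \<in> carrier_mat n z" and z: "0 < z" "z \<le> n"
  shows "0 \<le> sigma_min M"
    and "\<exists>v \<in> carrier_vec z. 0 < v \<bullet> v \<and> (M *\<^sub>v v) \<bullet> (M *\<^sub>v v) = (sigma_min M)\<^sup>2 * (v \<bullet> v)"
    and "\<And>y. y \<in> carrier_vec z \<Longrightarrow> (sigma_min M)\<^sup>2 * (y \<bullet> y) \<le> (M *\<^sub>v y) \<bullet> (M *\<^sub>v y)"
proof -
  let ?A = "transpose_mat M * M"
  have A: "?A \<in> carrier_mat z z" "transpose_mat ?A = ?A"
    using M by (auto simp: transpose_mult[of _ z n])
  have yAy: "y \<bullet> (?A *\<^sub>v y) = (M *\<^sub>v y) \<bullet> (M *\<^sub>v y)" if y: "y \<in> carrier_vec z" for y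
  proof -
    have "y \<bullet> (?A *\<^sub>v y) = (transpose_mat M *\<^sub>v (M *\<^sub>v y)) \<bullet> y"
      using M y by (simp add: comm_scalar_prod[of y z])
    also have "\<dots> = (M *\<^sub>v y) \<bullet> (M *\<^sub>v y)"
      by (rule transpose_vec_mult_scalar[OF M y]) (use M y in auto)
    finally show ?thesis .
  qed
  obtain \<mu> where \<mu>: "0 \<le> \<mu>" "\<mu> \<in> spectrum ?A"
    "\<And>y. y \<in> carrier_vec z \<Longrightarrow> \<mu> * (y \<bullet> y) \<le> y \<bullet> (?A *\<^sub>v y)"
    using symmetric_psd_min_eigenvalue[OF A z(1)] yAy scalar_prod_self_nonneg by metis
  \<comment> \<open>The Rayleigh quotient of an eigenvector is its eigenvalue. This gives attainment
    for \<open>\<mu>\<close>, and shows that no eigenvalue lies below \<open>\<mu>\<close>.\<close>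
  have eig: "\<exists>v \<in> carrier_vec z. 0 < v \<bullet> v \<and> v \<bullet> (?A *\<^sub>v v) = e * (v \<bullet> v)"
    if "e \<in> spectrum ?A" for e
  proof -
    obtain v where v: "v \<in> carrier_vec z" "v \<noteq> 0\<^sub>v z" "?A *\<^sub>v v = e \<cdot>\<^sub>v v"
      using \<open>e \<in> spectrum ?A\<close> M by (auto simp: spectrum_def eigenvalue_def eigenvector_def)
    then show ?thesis using scalar_prod_self_pos[OF v(1,2)] by (intro bexI[of _ v]) auto
  qed
  have least: "\<mu> \<le> e" if "e \<in> spectrum ?A" for e
    using eig[OF that] \<mu>(3) by (metis mult_le_cancel_right_pos)
  \<comment> \<open>The hypothesis \<open>z \<le> n\<close> selects the Gram matrix
    \<open>?A\<close> in \<open>singular_values\<close>.\<close>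
  have "sigma_min M = Min (sqrt ` spectrum ?A)"
    using M z by (simp add: sigma_min_def singular_values_def)
  also have "\<dots> = sqrt \<mu>"
    using \<mu>(2) least card_finite_spectrum(1)[OF A(1)] by (intro Min_eqI) auto
  finally have s: "sigma_min M = sqrt \<mu>" .
  then show "0 \<le> sigma_min M" using \<mu> by simp
  have s2: "(sigma_min M)\<^sup>2 = \<mu>" using s \<mu> by simp
  show "\<exists>v \<in> carrier_vec z. 0 < v \<bullet> v \<and> (M *\<^sub>v v) \<bullet> (M *\<^sub>v v) = (sigma_min M)\<^sup>2 * (v \<bullet> v)"
    using eig[OF \<mu>(2)] yAy s2 by auto
  show "(sigma_min M)\<^sup>2 * (y \<bullet> y) \<le> (M *\<^sub>v y) \<bullet> (M *\<^sub>v y)" if "y \<in> carrier_vec z" for y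
    using \<mu>(3)[OF that] yAy[OF that] s2 by simp
qed

section \<open>Appending a column\<close>

lemma scalar_prod_append_entry:
  fixes u v :: "real vec"
  assumes "u \<in> carrier_vec z" "v \<in> carrier_vec z"
  shows "(u @\<^sub>v vec 1 (\<lambda>_. s)) \<bullet> (v @\<^sub>v vec 1 (\<lambda>_. t)) = u \<bullet> v + s * t"
  using scalar_prod_append[OF assms(1) vec_carrier[of 1 "\<lambda>_. s"] assms(2) vec_carrier[of 1 "\<lambda>_. t"]]
  by (simp add: scalar_prod_def[of "vec _ _"])

lemma append_entry_carrier: "y \<in> carrier_vec z \<Longrightarrow> y @\<^sub>v vec 1 f \<in> carrier_vec (z + 1)"
  by (rule append_carrier_vec) auto

lemma append_col_carrier:
  assumes "M \<in> carrier_mat n z"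
  shows "append_col M x \<in> carrier_mat n (z + 1)"
  using assms by (auto simp: append_col_def)

lemma append_col_mult_vec:
  fixes M :: "real mat"
  assumes M: "M \<in> carrier_mat n z" and x: "x \<in> carrier_vec n" and y: "y \<in> carrier_vec z"
  shows "append_col M x *\<^sub>v (y @\<^sub>v vec 1 (\<lambda>_. t)) = M *\<^sub>v y + t \<cdot>\<^sub>v x"
proof (rule eq_vecI)
  fix i assume "i < dim_vec (M *\<^sub>v y + t \<cdot>\<^sub>v x)"
  then have i: "i < n" using x by simp
  have "row (append_col M x) i = row M i @\<^sub>v vec 1 (\<lambda>_. x $ i)"
    using M x i by (intro eq_vecI) (auto simp: append_col_def mat_of_cols_def nth_append)
  then show "(append_col M x *\<^sub>v (y @\<^sub>v vec 1 (\<lambda>_. t))) $ i = (M *\<^sub>v y + t \<cdot>\<^sub>v x) $ i"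
    using i M x y append_col_carrier[OF M, of x]
    by (simp del: One_nat_def add: scalar_prod_append_entry[of _ z])
qed (use append_col_carrier[OF M, of x] x in auto)

lemma sigma_min_append_col_le:
  fixes M :: "real mat"
  assumes M: "M \<in> carrier_mat n z" and z: "0 < z" "z < n" and x: "x \<in> carrier_vec n"
  shows "sigma_min (append_col M x) \<le> min (sigma_min M) (vnorm x)"
proof -
  let ?D = "append_col M x"
  have D: "?D \<in> carrier_mat n (z + 1)" by (rule append_col_carrier[OF M])
  \<comment> \<open>Strictness of \<open>z < n\<close> keeps the enlarged matrix tall, so the
    Rayleigh description covers both \<open>M\<close> and \<open>?D\<close>.\<close>
  have z': "0 < z + 1" "z + 1 \<le> n" "z \<le> n" using z by auto
  note low = sigma_min_rayleigh(3)[OF D z'(1,2)]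
  obtain v where v: "v \<in> carrier_vec z" "0 < v \<bullet> v"
      "(M *\<^sub>v v) \<bullet> (M *\<^sub>v v) = (sigma_min M)\<^sup>2 * (v \<bullet> v)"
    using sigma_min_rayleigh(2)[OF M z(1) z'(3)] by blast
  have 1: "M *\<^sub>v v + 0 \<cdot>\<^sub>v x = M *\<^sub>v v" using M v x by auto
  \<comment> \<open>Test vector \<open>(v, 0)\<close>: it has the norm of \<open>v\<close>, a
    minimiser for \<open>M\<close>, and the image \<open>M v\<close>.\<close>
  have "(sigma_min ?D)\<^sup>2 * (v \<bullet> v) \<le> (M *\<^sub>v v) \<bullet> (M *\<^sub>v v)"
    using low[OF append_entry_carrier[OF v(1), where f = "\<lambda>_. 0"]]
    by (simp only: append_col_mult_vec[OF M x v(1)] scalar_prod_append_entry[OF v(1) v(1)] 1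
        mult_zero_left add_0_right)
  then have "(sigma_min ?D)\<^sup>2 \<le> (sigma_min M)\<^sup>2" using v by simp
  then have "sigma_min ?D \<le> sigma_min M"
    using sigma_min_rayleigh(1)[OF M z(1) z'(3)] by (rule power2_le_imp_le)
  moreover have 2: "M *\<^sub>v 0\<^sub>v z + x = x" using M x by (intro eq_vecI) auto
  \<comment> \<open>Test vector \<open>(0, 1)\<close>: it has norm 1 and image
    \<open>x\<close>.\<close>
  have "(sigma_min ?D)\<^sup>2 \<le> x \<bullet> x"
    using low[OF append_entry_carrier[OF zero_carrier_vec, where f = "\<lambda>_. 1"]]
    by (simp del: One_nat_def
        add: append_col_mult_vec[OF M x] scalar_prod_append_entry[of _ z] 2)
  then have "sigma_min ?D \<le> vnorm x" unfolding vnorm_def by (rule real_le_rsqrt)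
  ultimately show ?thesis by simp
qed

lemma sigma_min_append_orthogonal_col:
  fixes M :: "real mat"
  assumes M: "M \<in> carrier_mat n z" and z: "0 < z" "z < n" and x: "x \<in> carrier_vec n"
    and orth: "\<And>i. i < z \<Longrightarrow> col M i \<bullet> x = 0"
  shows "sigma_min (append_col M x) = min (sigma_min M) (vnorm x)"
proof (rule antisym[OF sigma_min_append_col_le[OF M z x]])
  let ?D = "append_col M x" and ?m = "min (sigma_min M) (vnorm x)"
  have D: "?D \<in> carrier_mat n (z + 1)" by (rule append_col_carrier[OF M])
  have z': "0 < z + 1" "z + 1 \<le> n" "z \<le> n" using z by auto
  have m0: "0 \<le> ?m"
    using sigma_min_rayleigh(1)[OF M z(1) z'(3)] by (simp add: vnorm_def scalar_prod_self_nonneg)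
  \<comment> \<open>It is enough to bound the quotient from below at one minimiser \<open>w\<close>
    of \<open>?D\<close>, split as \<open>(y, t)\<close>.\<close>
  obtain w where w: "w \<in> carrier_vec (z + 1)" "0 < w \<bullet> w"
      "(?D *\<^sub>v w) \<bullet> (?D *\<^sub>v w) = (sigma_min ?D)\<^sup>2 * (w \<bullet> w)"
    using sigma_min_rayleigh(2)[OF D z'(1,2)] by blast
  define y where "y = vec_first w z"
  define t where "t = vec_last w 1 $ 0"
  have y: "y \<in> carrier_vec z" by (simp add: y_def)
  have "vec_last w 1 = vec 1 (\<lambda>_. t)" by (intro eq_vecI) (auto simp: t_def)
  then have weq: "w = y @\<^sub>v vec 1 (\<lambda>_. t)"
    using vec_first_last_append[OF w(1)] by (simp add: y_def)
  have My: "M *\<^sub>v y \<in> carrier_vec n" using M y by auto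
  have "transpose_mat M *\<^sub>v x = 0\<^sub>v z" using M orth by (intro eq_vecI) auto
  then have Myx: "x \<bullet> (M *\<^sub>v y) = 0"
    using transpose_vec_mult_scalar[OF M y x] y by simp
  \<comment> \<open>Pythagoras: \<open>x\<close> is orthogonal to the column space of
    \<open>M\<close>, so the mixed terms vanish.\<close>
  have "(?D *\<^sub>v w) \<bullet> (?D *\<^sub>v w) = (M *\<^sub>v y) \<bullet> (M *\<^sub>v y) + t\<^sup>2 * (x \<bullet> x)"
    unfolding weq append_col_mult_vec[OF M x y]
    using My x Myx comm_scalar_prod[OF x My]
    by (simp add: add_scalar_prod_distrib[of _ n] scalar_prod_add_distrib[of _ n] power2_eq_square)
  \<comment> \<open>Each summand is compared with \<open>?m^2\<close> separately: the part in
    \<open>y\<close> through \<open>sigma_min M\<close>, the part in \<open>t\<close> through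
    \<open>vnorm x\<close>.\<close>
  moreover have "?m\<^sup>2 * (y \<bullet> y) \<le> (sigma_min M)\<^sup>2 * (y \<bullet> y)"
    using m0 by (intro mult_right_mono power_mono scalar_prod_self_nonneg) auto
  moreover have "\<dots> \<le> (M *\<^sub>v y) \<bullet> (M *\<^sub>v y)"
    by (rule sigma_min_rayleigh(3)[OF M z(1) z'(3) y])
  moreover have "?m\<^sup>2 * t\<^sup>2 \<le> (vnorm x)\<^sup>2 * t\<^sup>2"
    using m0 by (intro mult_right_mono power_mono) auto
  moreover have "(vnorm x)\<^sup>2 = x \<bullet> x" by (simp add: vnorm_def scalar_prod_self_nonneg)
  moreover have "w \<bullet> w = y \<bullet> y + t\<^sup>2" unfolding weq using y
    by (simp del: One_nat_def add: scalar_prod_append_entry[of _ z] power2_eq_square)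
  ultimately have "?m\<^sup>2 * (w \<bullet> w) \<le> (sigma_min ?D)\<^sup>2 * (w \<bullet> w)"
    using w(3) by (simp add: algebra_simps)
  then have "?m\<^sup>2 \<le> (sigma_min ?D)\<^sup>2" using w(2) by simp
  then show "?m \<le> sigma_min ?D"
    using sigma_min_rayleigh(1)[OF D z'(1,2)] by (rule power2_le_imp_le)
qed

theorem theorem4:
  fixes n q :: nat and Dt :: "real mat" and D :: "real vec \<Rightarrow> real mat" and \<Delta> :: real
  assumes "2 \<le> q" and "q \<le> n"
    and "Dt \<in> carrier_mat n (q - 1)"
    and "\<And>x. x \<in> carrier_vec n \<Longrightarrow> D x = append_col Dt x"
    and "\<Delta> > 0"
  shows "(\<forall>x \<in> carrier_vec n. vnorm x = \<Delta> \<longrightarrow>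
            sigma_min (D x) \<le> min (sigma_min Dt) \<Delta>) \<and>
         (\<forall>x \<in> carrier_vec n. vnorm x = \<Delta> \<longrightarrow> (\<forall>i < q - 1. col Dt i \<bullet> x = 0) \<longrightarrow>
            sigma_min (D x) = min (sigma_min Dt) \<Delta>)"
proof -
  \<comment> \<open>With \<open>z = q - 1\<close>, \<open>2 \<le> q\<close> makes \<open>Dt\<close>
    have a column and \<open>q \<le> n\<close> makes \<open>D x\<close> tall.\<close>
  have q: "0 < q - 1" "q - 1 < n" using assms(1,2) by auto
  show ?thesis
    using sigma_min_append_col_le[OF assms(3) q] sigma_min_append_orthogonal_col[OF assms(3) q]
      assms(4) by metis
qed

end
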